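(* Let $a,b$ be integers with $2 \le a \le b$. Then there exists a unique integer $c_0 \in [ab-b,\,ab-1]$ such that, for every integer $c \ge b$, a cyclic matrix in $\mathrm{Skew}_3(\mathbb{Z})$ which is represented by the triple $(a,b,c)$ is mutation-acyclic if and only if $c > c_0$.
   Context: $\mathrm{Skew}_3(\mathbb{Z})$ is the set of skew-symmetric integral $3\times 3$ matrices. A matrix $B=[b_{ij}]\in \mathrm{Skew}_3(\mathbb{Z})$ determines a quiver $Q_B$ with set of points $\{1,2,3\}$ and with $b_{ij}$ arrows from $i$ to $j$ whenever $b_{ij}>0$. The map $B\mapsto Q_B$ is a bijection onto the set of quivers on $\{1,2,3\}$ with finitely many arrows and having neither loops nor oriented cycles of length two. Mutation of $B$ at $k$ corresponds to the following mutation of the quiver $Q=Q_B$ at the point $k$: (1) all arrows of $Q$ starting or ending at $k$ are reversed; (2) if $Q$ has $r_{ij}$ paths of length two from $i$ to $j$ passing through $k$, then $r_{ij}$ arrows from $i$ to $j$ are added; (3) all pairs of arrows forming cycles of length two are deleted (pairwise cancellation until no such pair remains). Matrices are considered up to simultaneous permutation of rows and columns and up to transposition (equivalently, quivers up to isomorphism and up to passing to the opposite quiver), and the mutation class of a matrix is the set of all matrices obtained from it by finite sequences of mutations, simultaneous row and column permutations, and transpositions. A matrix $B$ is cyclic if $Q_B$ contains an oriented cycle, and acyclic otherwise. $B$ is mutation-acyclic if some matrix in its mutation class is acyclic, and mutation-cyclic otherwise. For positive integers $a\le b\le c$, a cyclic matrix is represented by the triple $(a,b,c)$ if, up to simultaneous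 permutation of rows and columns and transposition, its quiver has exactly $a$ arrows from $2$ to $1$, $b$ arrows from $1$ to $3$, and $c$ arrows from $3$ to $2$. Every cyclic matrix in $\mathrm{Skew}_3(\mathbb{Z})$ is represented by a unique such triple. *)

theory Defs
  imports "HOL-Analysis.Finite_Cartesian_Product"
begin

text \<open>The points 1, 2, 3 are the three elements of the type \<^typ>\<open>3\<close>
  (in which the numeral 3 equals 0).\<close>

definition skew3 :: "(int ^ 3 ^ 3) set" where
  "skew3 = {B. transpose B = - B}"

text \<open>A quiver is given by its numbers of arrows: \<open>Q i j\<close> arrows from \<open>i\<close> to \<open>j\<close>.\<close>

type_synonym quiver = "3 \<Rightarrow> 3 \<Rightarrow> nat"

definition quiver_of :: "int ^ 3 ^ 3 \<Rightarrow> quiver" where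
  "quiver_of B i j = nat (B $ i $ j)"

definition matrix_of :: "quiver \<Rightarrow> int ^ 3 ^ 3" where
  "matrix_of Q = (\<chi> i j. int (Q i j) - int (Q j i))"

definition reverse_at :: "3 \<Rightarrow> quiver \<Rightarrow> quiver" where
  "reverse_at k Q i j = (if i = k \<or> j = k then Q j i else Q i j)"

definition paths_through :: "3 \<Rightarrow> quiver \<Rightarrow> quiver" where
  "paths_through k Q i j = Q i k * Q k j"

text \<open>Truncated subtraction: cancelling pairs of opposite arrows between \<open>i\<close> and \<open>j\<close>
  leaves exactly the excess in one direction. (It is only applied to quivers without loops.)\<close>

definition cancel_2_cycles :: "quiver \<Rightarrow> quiver" where
  "cancel_2_cycles Q i j = Q i j - Q j i"

text \<open>The paths of length two are those of the original quiver, before reversal.\<close>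

definition mutate_quiver :: "3 \<Rightarrow> quiver \<Rightarrow> quiver" where
  "mutate_quiver k Q =
     cancel_2_cycles (\<lambda>i j. reverse_at k Q i j + paths_through k Q i j)"

definition mutate :: "3 \<Rightarrow> int ^ 3 ^ 3 \<Rightarrow> int ^ 3 ^ 3" where
  "mutate k B = matrix_of (mutate_quiver k (quiver_of B))"

definition permute :: "(3 \<Rightarrow> 3) \<Rightarrow> int ^ 3 ^ 3 \<Rightarrow> int ^ 3 ^ 3" where
  "permute p B = (\<chi> i j. B $ p i $ p j)"

inductive_set mutation_class :: "int ^ 3 ^ 3 \<Rightarrow> (int ^ 3 ^ 3) set"
  for B :: "int ^ 3 ^ 3" where
  self: "B \<in> mutation_class B"
| mutate: "M \<in> mutation_class B \<Longrightarrow> mutate k M \<in> mutation_class B"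
| permute: "M \<in> mutation_class B \<Longrightarrow> bij p \<Longrightarrow> permute p M \<in> mutation_class B"
| transpose: "M \<in> mutation_class B \<Longrightarrow> transpose M \<in> mutation_class B"

definition cyclic_matrix :: "int ^ 3 ^ 3 \<Rightarrow> bool" where
  "cyclic_matrix B \<longleftrightarrow> \<not> acyclic {(i, j). quiver_of B i j > 0}"

definition mutation_acyclic :: "int ^ 3 ^ 3 \<Rightarrow> bool" where
  "mutation_acyclic B \<longleftrightarrow> (\<exists>M \<in> mutation_class B. \<not> cyclic_matrix M)"

text \<open>Arrow counts are exact: for a skew-symmetric matrix a positive entry at \<open>(i, j)\<close>
  excludes arrows from \<open>j\<close> to \<open>i\<close>, and there are no loops.\<close>

definition represented_by :: "int ^ 3 ^ 3 \<Rightarrow> int \<times> int \<times> int \<Rightarrow> bool" where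
  "represented_by B = (\<lambda>(a, b, c). 0 < a \<and> a \<le> b \<and> b \<le> c \<and>
     (\<exists>p M. bij p \<and> (M = permute p B \<or> M = transpose (permute p B)) \<and>
        int (quiver_of M 2 1) = a \<and> int (quiver_of M 1 3) = b \<and> int (quiver_of M 3 2) = c))"

lemma skew3_nth: "B \<in> skew3 \<Longrightarrow> B $ j $ i = - B $ i $ j"
proof -
  assume "B \<in> skew3"
  then have "transpose B $ i $ j = (- B) $ i $ j"
    by (simp only: skew3_def mem_Collect_eq)
  then show ?thesis
    by (simp only: transpose_def vec_lambda_beta uminus_vec_def)
qed

lemma matrix_of_quiver_of: "B \<in> skew3 \<Longrightarrow> matrix_of (quiver_of B) = B"
proof -
  assume "B \<in> skew3"
  then have "int (nat (B $ i $ j)) - int (nat (B $ j $ i)) = B $ i $ j" for i j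
    using skew3_nth[of B i j] by simp
  then show ?thesis
    unfolding matrix_of_def quiver_of_def by (simp only: vec_eq_iff vec_lambda_beta simp_thms)
qed

lemma quiver_of_matrix_of:
  "(\<And>i j. Q i j = 0 \<or> Q j i = 0) \<Longrightarrow> quiver_of (matrix_of Q) = Q"
proof (intro ext)
  fix i j
  assume "\<And>i j. Q i j = 0 \<or> Q j i = 0"
  from this[of i j] show "quiver_of (matrix_of Q) i j = Q i j"
    by (auto simp: matrix_of_def quiver_of_def)
qed

text \<open>The Fomin-Zelevinsky matrix mutation rule.\<close>

lemma mutate_nth:
  assumes "B \<in> skew3"
  shows "mutate k B $ i $ j =
    (if i = k \<or> j = k then - B $ i $ j
     else B $ i $ j + (\<bar>B $ i $ k\<bar> * B $ k $ j + B $ i $ k * \<bar>B $ k $ j\<bar>) div 2)"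
proof -
  have sk: "B $ j $ i = - B $ i $ j" for i j by (rule skew3_nth[OF assms])
  define x where "x = B $ i $ k"
  define y where "y = B $ k $ j"
  define z where "z = B $ i $ j"
  have e: "B $ k $ i = - x" "B $ j $ k = - y" "B $ j $ i = - z"
    unfolding x_def y_def z_def by (rule sk)+
  have d: "B $ k $ k = 0" using sk[of k k] by simp
  have trunc: "int (m - n) - int (n - m) = int m - int n" for m n :: nat by linarith
  define u where "u = (if i = k \<or> j = k then - z else z)"
  have r: "reverse_at k (quiver_of B) i j = nat u" "reverse_at k (quiver_of B) j i = nat (- u)"
    unfolding reverse_at_def quiver_of_def u_def e z_def[symmetric] by auto
  have "mutate k B $ i $ j =
      int (nat u + nat x * nat y) - int (nat (- u) + nat (- y) * nat (- x))"
    unfolding mutate_def matrix_of_def mutate_quiver_def cancel_2_cycles_def trunc vec_lambda_beta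
      r paths_through_def quiver_of_def e x_def[symmetric] y_def[symmetric] ..
  also have "\<dots> = u + (int (nat x * nat y) - int (nat (- y) * nat (- x)))"
    by (simp only: of_nat_add) linarith
  also have "int (nat x * nat y) - int (nat (- y) * nat (- x)) = (\<bar>x\<bar> * y + x * \<bar>y\<bar>) div 2"
  proof -
    have *: "\<bar>x\<bar> * y + x * \<bar>y\<bar> = 2 * (int (nat x * nat y) - int (nat (- y) * nat (- x)))"
      by (cases "x \<ge> 0"; cases "y \<ge> 0") (simp_all add: abs_if)
    show ?thesis
      unfolding * by (rule nonzero_mult_div_cancel_left[symmetric]) simp
  qed
  finally have main: "mutate k B $ i $ j = u + (\<bar>x\<bar> * y + x * \<bar>y\<bar>) div 2" .
  show ?thesis
  proof (cases "i = k \<or> j = k")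
    case True
    then have "x = 0 \<or> y = 0" using d unfolding x_def y_def by blast
    then show ?thesis using main True unfolding u_def z_def by auto
  next
    case False
    then show ?thesis using main unfolding u_def x_def y_def z_def by simp
  qed
qed

end

theory Submission
  imports Defs
begin

text \<open>
  Mutating an oriented triangle with \<open>x\<close>, \<open>y\<close>, \<open>z\<close> arrows replaces one of the numbers by the
  product of the other two minus itself, as long as the result is positive; if it is not, an
  acyclic quiver has been reached. The Markov function \<open>x\<^sup>2 + y\<^sup>2 + z\<^sup>2 - x y z\<close> does not change,
  because the two values of \<open>z\<close> exchanged by the mutation are the two roots of one quadratic
  polynomial. This decides mutation-acyclicity: a triangle is mutation-cyclic exactly if
  \<open>x\<close>, \<open>y\<close>, \<open>z\<close> are at least 2 and the Markov function is at most 4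
  (\<open>mutation_acyclic_iff_markov\<close>).

  One direction is an invariance argument: under these inequalities the new entry \<open>x y - z\<close> is
  again at least 2 (\<open>small_markov_mutate\<close>), so no acyclic matrix is ever reached. The other
  direction is a descent: if the inequalities fail, the mutation that changes the largest entry
  either makes the quiver acyclic or makes that entry strictly smaller (\<open>small_markov_of_no_descent\<close>), and the
  sum of the entries cannot decrease forever.

  For fixed \<open>a \<le> b\<close> it remains to look at the quadratic polynomial in \<open>c\<close>. It is at most 4 at
  \<open>c = b\<close>, hence also at the conjugate point \<open>a b - b\<close>, and exceeds 4 from \<open>a b\<close> on. The
  threshold \<open>c\<^sub>0\<close> is the largest integer at which its value is at most 4.
\<close>

section \<open>The Markov function\<close>

definition markov :: "int \<Rightarrow> int \<Rightarrow> int \<Rightarrow> int" where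
  "markov x y z = x^2 + y^2 + z^2 - x * y * z"

definition small_markov :: "int \<Rightarrow> int \<Rightarrow> int \<Rightarrow> bool" where
  "small_markov x y z \<longleftrightarrow> 2 \<le> x \<and> 2 \<le> y \<and> 2 \<le> z \<and> markov x y z \<le> 4"

lemma markov_rotate: "markov y z x = markov x y z"
  by (simp add: markov_def)

lemma markov_swap: "markov y x z = markov x y z"
  by (simp add: markov_def)

lemma markov_mutate: "markov x y (x * y - z) = markov x y z"
  by (simp add: markov_def power2_eq_square algebra_simps)

lemma markov_diff: "markov x y z - markov x y w = (z - w) * (z + w - x * y)"
  by (simp add: markov_def power2_eq_square algebra_simps)

lemma small_markov_rotate: "small_markov y z x \<longleftrightarrow> small_markov x y z"
  by (auto simp: small_markov_def markov_rotate)

lemma small_markov_swap: "small_markov y x z \<longleftrightarrow> small_markov x y z"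
  by (auto simp: small_markov_def markov_swap)

text \<open>The product of the conjugate values \<open>z\<close> and \<open>x y - z\<close> is \<open>x\<^sup>2 + y\<^sup>2\<close> minus the Markov
  function, hence positive, so the new value is at least 1. The value 1 is excluded because
  there the Markov function is \<open>1 + x\<^sup>2 - x y + y\<^sup>2 \<ge> 1 + x y \<ge> 5\<close>.\<close>

lemma small_markov_mutate:
  assumes "small_markov x y z"
  shows "small_markov x y (x * y - z)"
proof -
  have x: "2 \<le> x" and y: "2 \<le> y" and z: "2 \<le> z" and m: "markov x y z \<le> 4"
    using assms by (auto simp: small_markov_def)
  have sq: "4 \<le> x^2" "4 \<le> y^2" and xy: "4 \<le> x * y"
    using power_mono[OF x, of 2] power_mono[OF y, of 2] mult_mono[OF x y] x by auto
  have "z * (x * y - z) = x^2 + y^2 - markov x y z"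
    by (simp add: markov_def power2_eq_square algebra_simps)
  then have "0 < z * (x * y - z)"
    using m sq by linarith
  then have pos: "0 < x * y - z"
    using z by (simp add: zero_less_mult_iff)
  have "x * y - z \<noteq> 1"
  proof
    assume "x * y - z = 1"
    then have "markov x y 1 \<le> 4"
      using m markov_mutate[of x y z] by simp
    moreover have "markov x y 1 = (x - y)^2 + x * y + 1"
      by (simp add: markov_def power2_eq_square algebra_simps)
    ultimately show False
      using xy zero_le_power2[of "x - y"] by linarith
  qed
  then show ?thesis
    using x y m pos by (simp add: small_markov_def markov_mutate)
qed

text \<open>As a function of \<open>c\<close>, \<open>markov a b c\<close> decreases up to its vertex \<open>a b / 2\<close>, so the value at
  \<open>c = b\<close> bounds all values for \<open>b \<le> c \<le> a b / 2\<close>.\<close>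

lemma markov_diagonal_le:
  assumes "2 \<le> a" and "a \<le> b"
  shows "markov a b b \<le> 4"
proof -
  have "2 * a \<le> b * b"
    using assms by (intro mult_mono) auto
  then have "(a - 2) * (a + 2 - b * b) \<le> 0"
    using assms by (intro mult_nonneg_nonpos) auto
  moreover have "markov a b b = 4 + (a - 2) * (a + 2 - b * b)"
    by (simp add: markov_def power2_eq_square algebra_simps)
  ultimately show ?thesis by linarith
qed

lemma small_markov_of_no_descent:
  assumes "2 \<le> x" "2 \<le> y" "x \<le> z" "y \<le> z" and no_descent: "z \<le> x * y - z"
  shows "small_markov x y z"
proof -
  have ordered: "markov a b z \<le> 4" if "2 \<le> a" "a \<le> b" "b \<le> z" "z \<le> a * b - z" for a b
  proof -
    have "(z - b) * (z + b - a * b) \<le> 0"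
      using that by (intro mult_nonneg_nonpos) auto
    then show ?thesis
      using markov_diff[of a b z b] markov_diagonal_le[OF that(1,2)] by linarith
  qed
  have "markov x y z \<le> 4"
  proof (cases "x \<le> y")
    case True
    then show ?thesis using ordered[of x y] assms by simp
  next
    case False
    then show ?thesis
      using ordered[of y x] assms markov_swap[of x y z] by (simp add: mult.commute)
  qed
  then show ?thesis using assms by (simp add: small_markov_def)
qed

section \<open>Mutation of oriented triangles\<close>

text \<open>The entries around \<open>i \<rightarrow> j \<rightarrow> k \<rightarrow> i\<close> are recorded with their signs, so the same predicate also
  describes the quiver in which the mutation has turned around the arrows between \<open>k\<close> and \<open>i\<close>.
  Keeping the points variable makes relabelling unnecessary.\<close>

definition triangle :: "int ^ 3 ^ 3 \<Rightarrow> 3 \<Rightarrow> 3 \<Rightarrow> 3 \<Rightarrow> int \<Rightarrow> int \<Rightarrow> int \<Rightarrow> bool" where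
  "triangle B i j k x y z \<longleftrightarrow>
     B \<in> skew3 \<and> distinct [i, j, k] \<and> B $ i $ j = x \<and> B $ j $ k = y \<and> B $ k $ i = z"

lemma triangle_rotate: "triangle B i j k x y z \<Longrightarrow> triangle B j k i y z x"
  by (auto simp: triangle_def)

lemma three_points:
  fixes i j k m :: 3
  assumes "distinct [i, j, k]"
  shows "m = i \<or> m = j \<or> m = k"
proof -
  have "card {i, j, k} = CARD(3)"
    using assms by simp
  then have "{i, j, k} = UNIV"
    by (intro card_subset_eq) auto
  then show ?thesis by blast
qed

lemma skew3I:
  assumes "\<And>i j. B $ j $ i = - B $ i $ j"
  shows "B \<in> skew3"
proof -
  have "transpose B $ i $ j = (- B) $ i $ j" for i j
    using assms[of j i] by (simp add: transpose_def)
  then show ?thesis by (simp add: skew3_def vec_eq_iff)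
qed

lemma matrix_of_in_skew3: "matrix_of Q \<in> skew3"
  by (rule skew3I) (simp add: matrix_of_def)

lemma mutate_in_skew3: "mutate k B \<in> skew3"
  by (simp add: mutate_def matrix_of_in_skew3)

lemma transpose_in_skew3: "B \<in> skew3 \<Longrightarrow> transpose B \<in> skew3"
  by (rule skew3I, unfold transpose_def vec_lambda_beta, rule skew3_nth)

lemma permute_in_skew3: "B \<in> skew3 \<Longrightarrow> permute p B \<in> skew3"
  by (rule skew3I, unfold permute_def vec_lambda_beta, rule skew3_nth)

text \<open>Mutation reverses the arrows at the point \<open>j\<close>, so the triangle is read backwards
  afterwards.\<close>

lemma triangle_mutate:
  assumes t: "triangle B i j k x y z" and "0 < x" "0 < y"
  shows "triangle (mutate j B) k j i y x (x * y - z)"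
proof -
  have B: "B \<in> skew3" using t by (simp add: triangle_def)
  have e: "B $ i $ j = x" "B $ j $ k = y" "B $ k $ j = - y" "B $ j $ i = - x" "B $ i $ k = - z"
    using t skew3_nth[OF B, of j k] skew3_nth[OF B, of i j] skew3_nth[OF B, of k i]
    by (auto simp: triangle_def)
  then show ?thesis
    using t assms(2,3) by (auto simp: triangle_def mutate_in_skew3 mutate_nth[OF B])
qed

lemma triangle_transpose:
  "triangle B i j k x y z \<Longrightarrow> triangle (transpose B) k j i y x z"
  by (auto simp: triangle_def transpose_in_skew3) (simp_all add: transpose_def)

lemma triangle_permute:
  assumes "triangle B i j k x y z" and p: "bij p"
  shows "triangle (permute p B) (inv p i) (inv p j) (inv p k) x y z"
proof -
  have "inj (inv p)" and "p (inv p m) = m" for m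
    using p by (simp_all add: bij_imp_bij_inv bij_is_inj bij_is_surj surj_f_inv_f)
  then show ?thesis
    using assms(1) by (auto simp: triangle_def permute_in_skew3 inj_eq) (simp_all add: permute_def)
qed

lemma cyclic_matrix_triangle:
  assumes t: "triangle B i j k x y z" and "0 < x" "0 < y" "0 < z"
  shows "cyclic_matrix B"
proof -
  let ?E = "{(i, j). 0 < quiver_of B i j}"
  have "(i, j) \<in> ?E" "(j, k) \<in> ?E" "(k, i) \<in> ?E"
    using assms by (auto simp: triangle_def quiver_of_def)
  then have "(i, i) \<in> ?E\<^sup>+" by (meson trancl.simps)
  then show ?thesis by (auto simp: cyclic_matrix_def acyclic_def)
qed

lemma not_cyclic_matrix_triangle:
  assumes t: "triangle B i j k x y z" and "0 < x" "0 < y" "z \<le> 0"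
  shows "\<not> cyclic_matrix B"
proof -
  let ?E = "{(i, j). 0 < quiver_of B i j}"
  have B: "B \<in> skew3" and d: "distinct [i, j, k]" using t by (auto simp: triangle_def)
  \<comment> \<open>All arrows ascend in the order \<open>i\<close>, \<open>j\<close>, \<open>k\<close>.\<close>
  define rank :: "3 \<Rightarrow> nat" where "rank m = (if m = i then 0 else if m = j then 1 else 2)" for m
  have up: "rank m < rank n" if "(m, n) \<in> ?E" for m n
  proof -
    have "B $ m $ m = 0" for m using skew3_nth[OF B, of m m] by simp
    moreover have "B $ j $ i \<le> 0" "B $ k $ j \<le> 0" "B $ k $ i \<le> 0"
      using assms skew3_nth[OF B, of j i] skew3_nth[OF B, of k j] by (auto simp: triangle_def)
    moreover have "0 < B $ m $ n" using that by (simp add: quiver_of_def)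
    ultimately have "(m, n) \<in> {(i, j), (j, k), (i, k)}"
      using three_points[OF d, of m] three_points[OF d, of n] by fastforce
    then show ?thesis using d by (auto simp: rank_def)
  qed
  have "rank m < rank n" if "(m, n) \<in> ?E\<^sup>+" for m n
    using that by induction (use up in \<open>fastforce+\<close>)
  then show ?thesis by (fastforce simp: cyclic_matrix_def acyclic_def)
qed

section \<open>Mutation-acyclic triangles\<close>

text \<open>Every member of the class keeps an oriented triangle with small Markov function. It moves
  through the three points, which is why it is existentially quantified.\<close>

lemma small_markov_mutation_class:
  assumes "triangle B i j k x y z" "small_markov x y z" and "M \<in> mutation_class B"
  shows "\<exists>i j k x y z. triangle M i j k x y z \<and> small_markov x y z"
  using assms(3)
proof induction
  case self
  show ?case using assms by blast
next
  case (mutate M m)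
  then obtain i j k x y z where t: "triangle M i j k x y z" and s: "small_markov x y z"
    by blast
  have step: "?case" if t: "triangle M i m k x y z" and s: "small_markov x y z" for i k x y z
  proof -
    have "triangle (mutate m M) k m i y x (x * y - z)"
      using triangle_mutate[OF t] s by (simp add: small_markov_def)
    moreover have "small_markov y x (x * y - z)"
      using small_markov_mutate[OF s] by (simp add: small_markov_swap)
    ultimately show ?thesis by blast
  qed
  have "m = i \<or> m = j \<or> m = k"
    using t by (intro three_points) (simp add: triangle_def)
  then show ?case
    using step t s triangle_rotate[OF t] triangle_rotate[OF triangle_rotate[OF t]]
      small_markov_rotate by blast
next
  case (permute M p)
  then show ?case using triangle_permute by blast
next
  case (transpose M)
  then show ?case using triangle_transpose small_markov_swap by blast
qed

lemma mutation_class_trans: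
  assumes "N \<in> mutation_class M" "M \<in> mutation_class B"
  shows "N \<in> mutation_class B"
  using assms by induction (auto intro: mutation_class.intros)

lemma mutation_acyclic_mutate: "mutation_acyclic (mutate k B) \<Longrightarrow> mutation_acyclic B"
  unfolding mutation_acyclic_def
  by (meson mutation_class_trans mutation_class.mutate mutation_class.self)

text \<open>Descent on the sum of the entries. When some entry is 1, the product of the two smaller
  entries is at most the largest one, and one mutation already suffices.\<close>

lemma mutation_acyclic_of_not_small_markov:
  assumes "triangle B i j k x y z" "0 < x" "0 < y" "0 < z" "\<not> small_markov x y z"
  shows "mutation_acyclic B"
  using assms
proof (induction "nat (x + y + z)" arbitrary: B i j k x y z rule: less_induct)
  case less
  have largest: "mutation_acyclic B"
    if t: "triangle B i j k u v w" and pos: "0 < u" "0 < v" and le: "u \<le> w" "v \<le> w"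
      and big: "\<not> small_markov u v w" and sum: "u + v + w = x + y + z" for i j k u v w
  proof -
    have t': "triangle (mutate j B) k j i v u (u * v - w)"
      by (rule triangle_mutate[OF t pos])
    show ?thesis
    proof (cases "u * v \<le> w")
      case True
      then have "\<not> cyclic_matrix (mutate j B)"
        using not_cyclic_matrix_triangle[OF t'] pos by simp
      then show ?thesis
        unfolding mutation_acyclic_def by (blast intro: mutation_class.intros)
    next
      case False
      then have "u \<noteq> 1" "v \<noteq> 1" using le by auto
      then have two: "2 \<le> u" "2 \<le> v" using pos by auto
      have smaller: "u * v - w < w"
        using small_markov_of_no_descent[OF two le] big by linarith
      have "\<not> small_markov v u (u * v - w)"
        using big small_markov_mutate[of u v "u * v - w"] by (auto simp: small_markov_swap)
      moreover have "nat (v + u + (u * v - w)) < nat (x + y + z)"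
        using smaller sum False pos by linarith
      ultimately have "mutation_acyclic (mutate j B)"
        using less.hyps[OF _ t'] pos False by simp
      then show ?thesis by (rule mutation_acyclic_mutate)
    qed
  qed
  note t = less.prems(1)
  note t2 = triangle_rotate[OF t]
  note t3 = triangle_rotate[OF t2]
  have rotated: "\<not> small_markov y z x" "\<not> small_markov z x y"
    using less.prems(5) small_markov_rotate by blast+
  consider "x \<le> z" "y \<le> z" | "y \<le> x" "z \<le> x" | "z \<le> y" "x \<le> y" by linarith
  then show ?case
  proof cases
    case 1
    then show ?thesis using largest[OF t] less.prems by simp
  next
    case 2
    then show ?thesis using largest[OF t2] less.prems rotated by simp
  next
    case 3
    then show ?thesis using largest[OF t3] less.prems rotated by simp
  qed
qed

theorem mutation_acyclic_iff_markov:
  assumes t: "triangle B i j k x y z" and pos: "0 < x" "0 < y" "0 < z"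
  shows "mutation_acyclic B \<longleftrightarrow> \<not> small_markov x y z"
proof
  assume "mutation_acyclic B"
  then obtain M where M: "M \<in> mutation_class B" "\<not> cyclic_matrix M"
    by (auto simp: mutation_acyclic_def)
  show "\<not> small_markov x y z"
  proof
    assume "small_markov x y z"
    then obtain i j k x y z where "triangle M i j k x y z" "small_markov x y z"
      using small_markov_mutation_class[OF t] M(1) by blast
    then have "cyclic_matrix M"
      by (intro cyclic_matrix_triangle[of M i j k x y z]) (auto simp: small_markov_def)
    with M(2) show False by simp
  qed
qed (rule mutation_acyclic_of_not_small_markov[OF t pos])

section \<open>The threshold\<close>

lemma represented_by_triangle:
  assumes B: "B \<in> skew3" and r: "represented_by B (a, b, c)"
  obtains i j k where "triangle B i j k a b c" | i j k where "triangle B i j k b a c"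
proof -
  obtain p M where p: "bij p" and M: "M = permute p B \<or> M = transpose (permute p B)"
    and pos: "0 < a" "0 < b" "0 < c"
    and q: "int (quiver_of M 2 1) = a" "int (quiver_of M 1 3) = b" "int (quiver_of M 3 2) = c"
    using r by (auto simp: represented_by_def)
  have e: "M $ 2 $ 1 = a" "M $ 1 $ 3 = b" "M $ 3 $ 2 = c"
    using q pos by (auto simp: quiver_of_def split: if_splits)
  have inj: "p m = p n \<longleftrightarrow> m = n" for m n
    using p by (simp add: bij_is_inj inj_eq)
  from M show thesis
  proof
    assume "M = permute p B"
    then have "triangle B (p 2) (p 1) (p 3) a b c"
      using e B by (auto simp: triangle_def permute_def inj)
    then show thesis by (rule that(1))
  next
    assume "M = transpose (permute p B)"
    then have "triangle B (p 3) (p 1) (p 2) b a c"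
      using e B by (auto simp: triangle_def permute_def transpose_def inj)
    then show thesis by (rule that(2))
  qed
qed

lemma mutation_acyclic_iff_markov_represented:
  assumes B: "B \<in> skew3" "represented_by B (a, b, c)"
  shows "mutation_acyclic B \<longleftrightarrow> \<not> small_markov a b c"
proof -
  have pos: "0 < a" "0 < b" "0 < c" using B(2) by (auto simp: represented_by_def)
  show ?thesis
    using B
  proof (cases rule: represented_by_triangle)
    case (1 i j k)
    then show ?thesis using mutation_acyclic_iff_markov pos by blast
  next
    case (2 i j k)
    then show ?thesis using mutation_acyclic_iff_markov pos small_markov_swap by blast
  qed
qed

lemma represented_matrix_exists:
  assumes "0 < a" "a \<le> b" "b \<le> c"
  obtains B where "B \<in> skew3" "cyclic_matrix B" "represented_by B (a, b, c)"
proof -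
  define Q :: quiver where
    "Q i j = (if i = 2 \<and> j = 1 then nat a else if i = 1 \<and> j = 3 then nat b
       else if i = 3 \<and> j = 2 then nat c else 0)" for i j
  define B where "B = matrix_of Q"
  have B: "B \<in> skew3"
    by (simp add: B_def matrix_of_in_skew3)
  then have t: "triangle B 2 1 3 a b c"
    using assms by (simp add: triangle_def B_def matrix_of_def Q_def)
  moreover have "permute id B = B" by (simp add: permute_def vec_eq_iff)
  then have "represented_by B (a, b, c)"
    using t assms by (auto simp: represented_by_def triangle_def quiver_of_def
        intro!: exI[of _ id] exI[of _ B])
  ultimately show thesis
    using that B cyclic_matrix_triangle[OF t] assms by simp
qed

text \<open>For \<open>c \<ge> b\<close> the sum \<open>c + c\<^sub>0\<close> is at least \<open>a b\<close>, twice the vertex of the quadratic polynomial.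
  So its value at \<open>c \<le> c\<^sub>0\<close> is at most the value at \<open>c\<^sub>0\<close>, although \<open>c\<close> may lie below the vertex.\<close>

lemma markov_threshold:
  assumes a: "2 \<le> a" and ab: "a \<le> b"
  obtains c0 where "c0 \<in> {a * b - b .. a * b - 1}"
    and "\<And>c. b \<le> c \<Longrightarrow> small_markov a b c \<longleftrightarrow> c \<le> c0"
proof -
  let ?S = "{c \<in> {a * b - b .. a * b - 1}. markov a b c \<le> 4}"
  have start: "a * b - b \<in> ?S"
    using assms markov_diagonal_le[OF a ab] markov_mutate[of a b b] by auto
  have fin: "finite ?S" by (rule finite_subset[of _ "{a * b - b .. a * b - 1}"]) auto
  define c0 where "c0 = Max ?S"
  have c0: "c0 \<in> ?S"
    unfolding c0_def using start by (intro Max_in fin) blast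
  have max: "c \<le> c0" if "c \<in> ?S" for c
    unfolding c0_def using that by (intro Max_ge fin)
  have "small_markov a b c \<longleftrightarrow> c \<le> c0" if c: "b \<le> c" for c
  proof
    assume "c \<le> c0"
    then have "(c - c0) * (c + c0 - a * b) \<le> 0"
      using c c0 by (intro mult_nonpos_nonneg) auto
    then have "markov a b c \<le> 4"
      using markov_diff[of a b c c0] c0 by auto
    then show "small_markov a b c"
      using assms c by (simp add: small_markov_def)
  next
    assume s: "small_markov a b c"
    \<comment> \<open>The mutated entry is positive, which gives the upper end of the interval.\<close>
    then have "c \<le> a * b - 1"
      using small_markov_mutate[OF s] by (simp add: small_markov_def)
    moreover have "a * b - b \<le> c0" using c0 by simp
    moreover have "markov a b c \<le> 4" using s by (simp add: small_markov_def)
    ultimately show "c \<le> c0"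
      using max[of c] by (cases "a * b - b \<le> c") auto
  qed
  then show thesis using that c0 by blast
qed

theorem theorem1p2:
  fixes a b :: int
  assumes "2 \<le> a" and "a \<le> b"
  shows "\<exists>!c0. c0 \<in> {a * b - b .. a * b - 1} \<and>
    (\<forall>c \<ge> b. \<forall>B \<in> skew3. cyclic_matrix B \<and> represented_by B (a, b, c) \<longrightarrow>
       (mutation_acyclic B \<longleftrightarrow> c > c0))"
proof -
  obtain c0 where c0: "c0 \<in> {a * b - b .. a * b - 1}"
    and thr: "\<And>c. b \<le> c \<Longrightarrow> small_markov a b c \<longleftrightarrow> c \<le> c0"
    using markov_threshold[OF assms] by blast
  show ?thesis
  proof (rule ex1I[of _ c0], intro conjI allI impI ballI)
    show "c0 \<in> {a * b - b .. a * b - 1}" by (rule c0)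
    show "mutation_acyclic B \<longleftrightarrow> c > c0"
      if "b \<le> c" "B \<in> skew3" "cyclic_matrix B \<and> represented_by B (a, b, c)" for c B
      using mutation_acyclic_iff_markov_represented[of B a b c] thr[of c] that by auto
  next
    fix d
    assume d: "d \<in> {a * b - b .. a * b - 1} \<and>
      (\<forall>c \<ge> b. \<forall>B \<in> skew3. cyclic_matrix B \<and> represented_by B (a, b, c) \<longrightarrow>
         (mutation_acyclic B \<longleftrightarrow> c > d))"
    have same: "c \<le> d \<longleftrightarrow> c \<le> c0" if c: "b \<le> c" for c
    proof -
      obtain B where B: "B \<in> skew3" "cyclic_matrix B" "represented_by B (a, b, c)"
        using represented_matrix_exists[of a b c] assms c by auto
      then have "mutation_acyclic B \<longleftrightarrow> c > d" using d c by blast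
      then show ?thesis
        using mutation_acyclic_iff_markov_represented[OF B(1,3)] thr[OF c] by auto
    qed
    \<comment> \<open>Both candidates are at least \<open>b\<close>, so each can be tested against the other.\<close>
    have "2 * b \<le> a * b" using assms by (intro mult_right_mono) auto
    moreover have "a * b - b \<le> d" "a * b - b \<le> c0" using d c0 by auto
    ultimately have "b \<le> d" "b \<le> c0" by linarith+
    then show "d = c0" using same[of d] same[of c0] by auto
  qed
qed

end
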